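(* Let $n,i,j$ be integers with $1\le i<j\le n$, let $k$ be a field, let $R=k[x_1,\dots,x_n]$, and let $I=(x_1^2,\dots,x_n^2)+\mathrm{RLex}(x_ix_j)$. Then the Hilbert series of $R/I$ is $$\mathrm{HS}(R/I;t)=(1+t)^{n-j}\bigl(1+jt+(j-i-1)t^2\bigr).$$
   Context: The reverse lexicographic order with $x_1>\cdots>x_n$: for two monomials of the same degree, $x_1^{a_1}\cdots x_n^{a_n}>x_1^{b_1}\cdots x_n^{b_n}$ if the last non-zero entry of $(a_1,\dots,a_n)-(b_1,\dots,b_n)$ is negative. For $1\le i<j\le n$, $\mathrm{RLex}(x_ix_j)$ is the ideal of $R$ generated by all square-free monomials of degree 2 that are greater than or equal to $x_ix_j$ in this order; that is, by all $x_ax_b$ with $1\le a<b\le j-1$ together with $x_ax_j$ for $1\le a\le i$. The Hilbert series of a standard graded $k$-algebra $A=\bigoplus_{d\ge0}A_d$ is $\mathrm{HS}(A;t)=\sum_{d\ge 0}\dim_k(A_d)\,t^d$. *)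

theory Defs
  imports
    "HOL-Library.Poly_Mapping"
    "HOL-Algebra.Embedded_Algebras"
    "HOL-Algebra.QuotRing"
    "HOL-Computational_Algebra.Formal_Power_Series"
begin

text \<open>
  A monomial is its finitely supported exponent function, the exponent of \<open>x\<^sub>l\<close> being stored at
  index \<open>l\<close>, and a polynomial is a finitely supported function from monomials to coefficients.
  Multiplication on the type \<open>(nat \<Rightarrow>\<^sub>0 nat) \<Rightarrow>\<^sub>0 'k\<close> is convolution, that is, multiplication of
  polynomials in the variables \<open>x\<^sub>0, x\<^sub>1, x\<^sub>2, \<dots>\<close>; the ring \<open>k[x\<^sub>1, \<dots>, x\<^sub>n]\<close> is the subring of
  those polynomials that involve only \<open>x\<^sub>1, \<dots>, x\<^sub>n\<close>.
\<close>

type_synonym monomial = "nat \<Rightarrow>\<^sub>0 nat"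

type_synonym 'k mpoly = "monomial \<Rightarrow>\<^sub>0 'k"

definition monomials :: "nat \<Rightarrow> monomial set"
  where "monomials n = {m. Poly_Mapping.keys m \<subseteq> {1..n}}"

definition poly_ring_upto :: "nat \<Rightarrow> ('k::field) mpoly ring"
  where "poly_ring_upto n =
    \<lparr>carrier = {p. Poly_Mapping.keys p \<subseteq> monomials n},
     monoid.mult = (*), one = 1, zero = 0, add = (+)\<rparr>"

definition mdeg :: "monomial \<Rightarrow> nat"
  where "mdeg m = (\<Sum>l\<in>Poly_Mapping.keys m. Poly_Mapping.lookup m l)"

definition monom_poly :: "monomial \<Rightarrow> ('k::field) mpoly"
  where "monom_poly m = Poly_Mapping.single m 1"

definition var_mon :: "nat \<Rightarrow> monomial"
  where "var_mon l = Poly_Mapping.single l 1"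

definition var :: "nat \<Rightarrow> ('k::field) mpoly"
  where "var l = monom_poly (var_mon l)"

definition const_poly :: "'k \<Rightarrow> ('k::field) mpoly"
  where "const_poly c = Poly_Mapping.single 0 c"

definition homogeneous_part :: "nat \<Rightarrow> nat \<Rightarrow> ('k::field) mpoly set"
  where "homogeneous_part n d =
    {p \<in> carrier (poly_ring_upto n). \<forall>m\<in>Poly_Mapping.keys p. mdeg m = d}"

text \<open>
  \<open>revlex_greater a b\<close> means \<open>a > b\<close> in the reverse lexicographic order with
  \<open>x\<^sub>1 > x\<^sub>2 > \<dots>\<close>.  It compares only monomials of the same degree.
\<close>

definition revlex_greater :: "monomial \<Rightarrow> monomial \<Rightarrow> bool"
  where "revlex_greater a b \<longleftrightarrow> mdeg a = mdeg b \<and>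
    (\<exists>l. int (Poly_Mapping.lookup a l) - int (Poly_Mapping.lookup b l) < 0 \<and>
          (\<forall>l'>l. Poly_Mapping.lookup a l' = Poly_Mapping.lookup b l'))"

definition squarefree_monomial :: "monomial \<Rightarrow> bool"
  where "squarefree_monomial m \<longleftrightarrow> (\<forall>l. Poly_Mapping.lookup m l \<le> 1)"

definition RLex :: "nat \<Rightarrow> monomial \<Rightarrow> ('k::field) mpoly set"
  where "RLex n u = Idl\<^bsub>poly_ring_upto n\<^esub>
    (monom_poly ` {m \<in> monomials n. squarefree_monomial m \<and> mdeg m = 2 \<and>
                                   (revlex_greater m u \<or> m = u)})"

text \<open>
  For a ring \<open>A\<close> with coefficient field \<open>K\<close> (a subfield of \<open>A\<close>) and graded components \<open>gr d\<close>.
  If some component were not finite-dimensional over \<open>K\<close>, the corresponding coefficient would be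
  unspecified.
\<close>

definition hilbert_series :: "('a, 'b) ring_scheme \<Rightarrow> 'a set \<Rightarrow> (nat \<Rightarrow> 'a set) \<Rightarrow> int fps"
  where "hilbert_series A K gr = Abs_fps (\<lambda>d. int (ring.dim A K (gr d)))"

text \<open>
  The standard graded algebra \<open>R/I\<close>, for \<open>R = k[x\<^sub>1, \<dots>, x\<^sub>n]\<close> and a homogeneous proper ideal \<open>I\<close>:
  the coefficient field and the graded components are the images of those of \<open>R\<close>.
\<close>

definition quotient_image :: "nat \<Rightarrow> ('k::field) mpoly set \<Rightarrow> 'k mpoly set \<Rightarrow> 'k mpoly set set"
  where "quotient_image n I S = (\<lambda>p. I +>\<^bsub>poly_ring_upto n\<^esub> p) ` S"

definition quotient_HS :: "nat \<Rightarrow> ('k::field) mpoly set \<Rightarrow> int fps"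
  where "quotient_HS n I = hilbert_series (poly_ring_upto n Quot I)
    (quotient_image n I (range const_poly)) (\<lambda>d. quotient_image n I (homogeneous_part n d))"

end

theory Submission
  imports Defs
begin

text \<open>
  An ideal generated by monomials is spanned by the monomials it contains, so the graded components
  of its quotient have the remaining (standard) monomials as bases.  Modulo the squares of the
  variables and square-free generators, the standard monomials are the \<open>x\<^sub>S\<close> whose support
  \<open>S\<close> contains the support of no generator.  For \<open>RLex(x\<^sub>i x\<^sub>j)\<close> this only restricts
  \<open>S \<inter> {1..j}\<close>, which must be empty, a singleton, or \<open>{a, j}\<close> with \<open>i < a < j\<close>; the
  variables beyond \<open>x\<^sub>j\<close> are free and contribute the factor \<open>(1 + t)\<^bsup>n - j\<^esup>\<close>.
\<close>

section \<open>The polynomial ring\<close>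

lemma poly_ring_upto_simps [simp]:
  "carrier (poly_ring_upto n) = {p. Poly_Mapping.keys p \<subseteq> monomials n}"
  "monoid.mult (poly_ring_upto n) = (*)"
  "one (poly_ring_upto n) = 1"
  "zero (poly_ring_upto n) = 0"
  "add (poly_ring_upto n) = (+)"
  by (simp_all add: poly_ring_upto_def)

lemma keys_add_nat: "Poly_Mapping.keys (a + b :: monomial) = Poly_Mapping.keys a \<union> Poly_Mapping.keys b"
  by (auto simp: in_keys_iff lookup_add)

lemma monomials_add: "a + b \<in> monomials n \<longleftrightarrow> a \<in> monomials n \<and> b \<in> monomials n"
  by (auto simp: monomials_def keys_add_nat)

lemma monomial_dvd_iff:
  "(\<exists>c. (m :: monomial) = g + c) \<longleftrightarrow> (\<forall>l. Poly_Mapping.lookup g l \<le> Poly_Mapping.lookup m l)"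
proof
  assume "\<forall>l. Poly_Mapping.lookup g l \<le> Poly_Mapping.lookup m l"
  \<comment> \<open>Subtraction of exponents is truncated pointwise; the hypothesis is what makes it
    exact here.\<close>
  then have "m = g + (m - g)"
    by (intro poly_mapping_eqI) (simp add: lookup_add lookup_minus)
  then show "\<exists>c. m = g + c" ..
qed (auto simp: lookup_add)

lemma mpoly_keys_uminus: "Poly_Mapping.keys (- p) = Poly_Mapping.keys (p :: 'k::field mpoly)"
  by (auto simp: in_keys_iff)

lemma mpoly_keys_mult:
  fixes p q :: "'k::field mpoly"
  assumes "Poly_Mapping.keys p \<subseteq> A" "Poly_Mapping.keys q \<subseteq> B" "\<And>a b. a \<in> A \<Longrightarrow> b \<in> B \<Longrightarrow> a + b \<in> C"
  shows "Poly_Mapping.keys (p * q) \<subseteq> C"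
  using keys_mult[of p q] assms by blast

lemma cring_poly_ring_upto: "cring (poly_ring_upto n :: 'k::field mpoly ring)"
proof (intro cringI abelian_groupI comm_monoidI)
  fix p :: "'k mpoly"
  assume "p \<in> carrier (poly_ring_upto n)"
  then show "\<exists>q\<in>carrier (poly_ring_upto n). q \<oplus>\<^bsub>poly_ring_upto n\<^esub> p = \<zero>\<^bsub>poly_ring_upto n\<^esub>"
    by (intro bexI[of _ "- p"]) (auto simp: mpoly_keys_uminus)
next
  fix p q :: "'k mpoly"
  assume "p \<in> carrier (poly_ring_upto n)" "q \<in> carrier (poly_ring_upto n)"
  then show "p \<oplus>\<^bsub>poly_ring_upto n\<^esub> q \<in> carrier (poly_ring_upto n)"
    using keys_add[of p q] by auto
  from \<open>p \<in> _\<close> \<open>q \<in> _\<close> show "p \<otimes>\<^bsub>poly_ring_upto n\<^esub> q \<in> carrier (poly_ring_upto n)"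
    by (auto dest!: subsetD[OF keys_mult] simp: monomials_add)
qed (auto simp: algebra_simps monomials_def)

lemma poly_ring_upto_a_inv:
  assumes "p \<in> carrier (poly_ring_upto n)"
  shows "\<ominus>\<^bsub>poly_ring_upto n\<^esub> p = - (p :: 'k::field mpoly)"
proof -
  interpret cring "poly_ring_upto n :: 'k mpoly ring" by (rule cring_poly_ring_upto)
  show ?thesis
    by (rule minus_equality) (use assms in \<open>auto simp: mpoly_keys_uminus\<close>)
qed

text \<open>The embedded copy of \<open>k\<close> in the polynomial ring; its image in the quotient
  is the field over which dimensions are taken.\<close>

lemma subfield_const_poly: "subfield (range const_poly) (poly_ring_upto n :: 'k::field mpoly ring)"
proof -
  interpret cring "poly_ring_upto n :: 'k mpoly ring" by (rule cring_poly_ring_upto)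
  have carr: "const_poly c \<in> carrier (poly_ring_upto n)" for c :: 'k
    by (auto simp: const_poly_def monomials_def)
  have mult: "const_poly c * const_poly d = const_poly (c * d)" for c d :: 'k
    by (simp add: const_poly_def mult_single)
  have one: "1 = (const_poly 1 :: 'k mpoly)" and zero: "0 = (const_poly 0 :: 'k mpoly)"
    by (simp_all add: const_poly_def)
  have eq_iff: "const_poly c = const_poly d \<longleftrightarrow> c = d" for c d :: 'k
    by (metis const_poly_def lookup_single_eq)
  show ?thesis
  proof (intro subfieldI subcringI' subringI)
    show "range const_poly \<subseteq> carrier (poly_ring_upto n :: 'k mpoly ring)"
      using carr by blast
    show "\<one>\<^bsub>poly_ring_upto n\<^esub> \<in> range (const_poly :: 'k \<Rightarrow> _)"
      using one by auto
  next
    fix h :: "'k mpoly"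
    assume "h \<in> range const_poly"
    then obtain c where h: "h = const_poly c" ..
    have "\<ominus>\<^bsub>poly_ring_upto n\<^esub> h = const_poly (- c)"
      using poly_ring_upto_a_inv[OF carr] by (simp add: h const_poly_def single_uminus)
    then show "\<ominus>\<^bsub>poly_ring_upto n\<^esub> h \<in> range const_poly" by simp
  next
    fix g h :: "'k mpoly"
    assume "g \<in> range const_poly" "h \<in> range const_poly"
    then obtain c d where "g = const_poly c" "h = const_poly d" by blast
    then show "g \<otimes>\<^bsub>poly_ring_upto n\<^esub> h \<in> range const_poly"
      and "g \<oplus>\<^bsub>poly_ring_upto n\<^esub> h \<in> range const_poly"
      by (auto simp: mult) (auto simp: const_poly_def simp flip: single_add)
  next
    \<comment> \<open>Inverting \<open>c\<close> in the coefficient field gives an inverse that is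
      again constant, so units can be computed inside the subring.\<close>
    have "\<exists>d. const_poly d * const_poly c = (1 :: 'k mpoly) \<and> const_poly c * const_poly d = (1 :: 'k mpoly)"
      if "c \<noteq> 0" for c :: 'k
      using that by (intro exI[of _ "1 / c"]) (simp add: mult one)
    then show "Units (poly_ring_upto n\<lparr>carrier := range const_poly\<rparr>) =
        range const_poly - {\<zero>\<^bsub>poly_ring_upto n :: 'k mpoly ring\<^esub>}"
      unfolding Units_def by (auto simp: mult one zero eq_iff) 
  qed
qed


section \<open>Monomial ideals\<close>

text \<open>The \<open>k\<close>-linear span of the monomials in \<open>M\<close>. It serves both
  for monomial ideals and for the graded components of the polynomial ring.\<close>

definition monomial_span :: "monomial set \<Rightarrow> ('k::field) mpoly set"
  where "monomial_span M = {p. Poly_Mapping.keys p \<subseteq> M}"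

text \<open>The monomials of the ideal generated by \<open>G\<close>. The cofactor \<open>c\<close>
  is left unrestricted: as a factor of a monomial in \<open>x_1, ..., x_n\<close> it involves only
  these variables.\<close>

definition monomial_multiples :: "nat \<Rightarrow> monomial set \<Rightarrow> monomial set"
  where "monomial_multiples n G = {m \<in> monomials n. \<exists>g\<in>G. \<exists>c. m = g + c}"

lemma monomial_span_add: "p \<in> monomial_span M \<Longrightarrow> q \<in> monomial_span M \<Longrightarrow> p + q \<in> monomial_span M"
  using keys_add[of p q] by (auto simp: monomial_span_def)

lemma monomial_span_mono: "M \<subseteq> N \<Longrightarrow> monomial_span M \<subseteq> monomial_span N"
  by (auto simp: monomial_span_def)

lemma single_in_monomial_span: "m \<in> M \<Longrightarrow> Poly_Mapping.single m c \<in> monomial_span M"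
  by (simp add: monomial_span_def)

lemma zero_in_monomial_span: "0 \<in> monomial_span M"
  by (simp add: monomial_span_def)

lemma monomial_span_induct [consumes 1, case_names zero add]:
  assumes "p \<in> monomial_span M"
    and "P 0"
    and add: "\<And>m c q. m \<in> M \<Longrightarrow> q \<in> monomial_span M \<Longrightarrow> P q \<Longrightarrow> P (Poly_Mapping.single m c + q)"
  shows "P p"
  using assms(1)
proof (induction p rule: update_induct)
  case (update f a b)
  \<comment> \<open>The index \<open>a\<close> is not yet a key of \<open>f\<close>, so setting its
    coefficient is the same as adding a term.\<close>
  have "Poly_Mapping.update a b f = Poly_Mapping.single a b + f"
    using update by (intro poly_mapping_eqI)
      (auto simp: lookup_update lookup_add lookup_single when_def in_keys_iff)
  moreover have "a \<in> M" "f \<in> monomial_span M"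
    using update by (auto simp: monomial_span_def keys_update split: if_splits)
  ultimately show ?case
    using add update by simp
qed (rule assms(2))

lemma monomial_span_insert:
  assumes "p \<in> monomial_span (insert m M)"
  obtains c q where "p = Poly_Mapping.single m c + q" "q \<in> monomial_span M"
proof
  let ?c = "Poly_Mapping.lookup p m"
  show "p = Poly_Mapping.single m ?c + (p - Poly_Mapping.single m ?c)" by simp
  show "p - Poly_Mapping.single m ?c \<in> monomial_span M"
    using assms by (auto simp: monomial_span_def in_keys_iff lookup_minus lookup_single when_def split: if_splits)
qed

text \<open>Every monomial of a product \<open>p * q\<close> is a product of a monomial of
  \<open>p\<close> and one of \<open>q\<close>, so closure under multiplication by monomials already
  gives closure under multiplication by polynomials.\<close>

lemma ideal_monomial_span:
  assumes M: "M \<subseteq> monomials n" and closed: "\<And>m c. m \<in> M \<Longrightarrow> c \<in> monomials n \<Longrightarrow> m + c \<in> M"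
  shows "ideal (monomial_span M) (poly_ring_upto n :: 'k::field mpoly ring)"
proof -
  interpret cring "poly_ring_upto n :: 'k mpoly ring" by (rule cring_poly_ring_upto)
  have carr: "monomial_span M \<subseteq> carrier (poly_ring_upto n :: 'k mpoly ring)"
    using M by (auto simp: monomial_span_def)
  have mult: "p * q \<in> monomial_span M"
    if "p \<in> monomial_span M" "q \<in> carrier (poly_ring_upto n)" for p q :: "'k mpoly"
    using that mpoly_keys_mult[of p M q "monomials n" M] closed by (auto simp: monomial_span_def)
  show ?thesis
  proof (rule idealI)
    show "subgroup (monomial_span M) (add_monoid (poly_ring_upto n :: 'k mpoly ring))"
    proof (rule add.subgroupI)
      show "monomial_span M \<noteq> ({} :: 'k mpoly set)"
        using zero_in_monomial_span by blast
    next
      fix p :: "'k mpoly"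
      assume "p \<in> monomial_span M"
      then show "\<ominus>\<^bsub>poly_ring_upto n\<^esub> p \<in> monomial_span M"
        using carr by (subst poly_ring_upto_a_inv) (auto simp: monomial_span_def mpoly_keys_uminus)
    qed (use carr in \<open>auto intro: monomial_span_add\<close>)
  qed (use mult in \<open>auto simp: mult.commute ring_axioms\<close>)
qed

lemma ideal_monomial_multiples:
  "ideal (monomial_span (monomial_multiples n G)) (poly_ring_upto n :: 'k::field mpoly ring)"
proof (rule ideal_monomial_span)
  show "m + c \<in> monomial_multiples n G" if "m \<in> monomial_multiples n G" "c \<in> monomials n" for m c
    using that unfolding monomial_multiples_def mem_Collect_eq monomials_add by (metis add.assoc)
qed (auto simp: monomial_multiples_def)

text \<open>The span of the multiples is an ideal containing the generators, hence contains the
  generated ideal. Conversely each term \<open>c * m\<close> with \<open>m = g + b\<close> is the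
  generator \<open>g\<close> times the polynomial \<open>c * b\<close>, and terms add up to
  arbitrary elements of the span.\<close>

lemma Idl_monomials:
  assumes "G \<subseteq> monomials n"
  shows "Idl\<^bsub>poly_ring_upto n\<^esub> (monom_poly ` G) =
    (monomial_span (monomial_multiples n G) :: 'k::field mpoly set)"
proof -
  interpret cring "poly_ring_upto n :: 'k mpoly ring" by (rule cring_poly_ring_upto)
  have carr: "monom_poly ` G \<subseteq> carrier (poly_ring_upto n :: 'k mpoly ring)"
    using assms by (auto simp: monom_poly_def)
  interpret J: ideal "Idl\<^bsub>poly_ring_upto n\<^esub> (monom_poly ` G)" "poly_ring_upto n :: 'k mpoly ring"
    by (rule genideal_ideal[OF carr])
  show ?thesis
  proof
    show "Idl\<^bsub>poly_ring_upto n\<^esub> (monom_poly ` G) \<subseteq> (monomial_span (monomial_multiples n G) :: 'k mpoly set)"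
    proof (rule genideal_minimal[OF ideal_monomial_multiples])
      have "G \<subseteq> monomial_multiples n G"
        using assms by (force simp: monomial_multiples_def intro: exI[of _ 0])
      then show "monom_poly ` G \<subseteq> (monomial_span (monomial_multiples n G) :: 'k mpoly set)"
        by (auto simp: monom_poly_def single_in_monomial_span)
    qed
  next
    show "(monomial_span (monomial_multiples n G) :: 'k mpoly set) \<subseteq> Idl\<^bsub>poly_ring_upto n\<^esub> (monom_poly ` G)"
    proof
      fix p :: "'k mpoly"
      assume "p \<in> monomial_span (monomial_multiples n G)"
      then show "p \<in> Idl\<^bsub>poly_ring_upto n\<^esub> (monom_poly ` G)"
      proof (induction rule: monomial_span_induct)
        case zero
        then show ?case using J.zero_closed by simp
      next
        case (add m c q)
        then obtain g b where gb: "g \<in> G" "m = g + b" "b \<in> monomials n"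
          by (auto simp: monomial_multiples_def monomials_add)
        have "monom_poly g \<in> Idl\<^bsub>poly_ring_upto n\<^esub> (monom_poly ` G :: 'k mpoly set)"
          using genideal_self[OF carr] gb by blast
        from J.I_r_closed[OF this, of "Poly_Mapping.single b c"] gb
        have "Poly_Mapping.single m c \<in> Idl\<^bsub>poly_ring_upto n\<^esub> (monom_poly ` G :: 'k mpoly set)"
          by (simp add: monom_poly_def mult_single)
        then show ?case using J.a_closed add by simp
      qed
    qed
  qed
qed

text \<open>The sum of two ideals is the ideal generated by their union, and this is already
  generated by the union of the two generating sets; so the sum is again a monomial ideal.\<close>

lemma sum_Idl_monomials:
  assumes "G \<subseteq> monomials n" "H \<subseteq> monomials n"
  shows "Idl\<^bsub>poly_ring_upto n\<^esub> (monom_poly ` G) <+>\<^bsub>poly_ring_upto n\<^esub> Idl\<^bsub>poly_ring_upto n\<^esub> (monom_poly ` H) =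
    (monomial_span (monomial_multiples n (G \<union> H)) :: 'k::field mpoly set)"
proof -
  interpret cring "poly_ring_upto n :: 'k mpoly ring" by (rule cring_poly_ring_upto)
  have carr: "monom_poly ` (G \<union> H) \<subseteq> carrier (poly_ring_upto n :: 'k mpoly ring)"
    using assms by (auto simp: monom_poly_def)
  let ?J = "\<lambda>G. Idl\<^bsub>poly_ring_upto n\<^esub> (monom_poly ` G :: 'k mpoly set)"
  have carr': "monom_poly ` G \<subseteq> carrier (poly_ring_upto n :: 'k mpoly ring)"
      "monom_poly ` H \<subseteq> carrier (poly_ring_upto n :: 'k mpoly ring)"
    using carr by auto
  have "?J G \<union> ?J H \<subseteq> ?J (G \<union> H)"
    using carr carr' by (intro Un_least genideal_minimal genideal_ideal order_trans[OF _ genideal_self]) auto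
  moreover have JJ: "?J G \<union> ?J H \<subseteq> carrier (poly_ring_upto n)"
    using ideal.Icarr[OF genideal_ideal[OF carr'(1)]] ideal.Icarr[OF genideal_ideal[OF carr'(2)]] by auto
  moreover have "monom_poly ` (G \<union> H) \<subseteq> ?J G \<union> ?J H"
    using genideal_self[OF carr'(1)] genideal_self[OF carr'(2)] by (simp add: image_Un le_supI1 le_supI2)
  ultimately have "Idl\<^bsub>poly_ring_upto n\<^esub> (?J G \<union> ?J H) = ?J (G \<union> H)"
    by (intro equalityI genideal_minimal genideal_ideal carr order_trans[OF _ genideal_self[OF JJ]]) auto
  then show ?thesis
    using union_genideal[OF genideal_ideal[OF carr'(1)] genideal_ideal[OF carr'(2)]]
      Idl_monomials[of "G \<union> H" n] assms by auto
qed


section \<open>The Hilbert series counts standard monomials\<close>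

text \<open>Representatives of one coset differ by a polynomial supported on \<open>B\<close>, so
  coefficients outside \<open>B\<close> are invariants of the coset. This gives the linear
  independence of the standard monomials.\<close>

lemma coset_eq_imp_lookup_eq:
  fixes p q :: "'k::field mpoly"
  assumes "ideal (monomial_span B) (poly_ring_upto n :: 'k mpoly ring)"
    and "p \<in> carrier (poly_ring_upto n)"
    and "monomial_span B +>\<^bsub>poly_ring_upto n\<^esub> p = monomial_span B +>\<^bsub>poly_ring_upto n\<^esub> q"
    and "m \<notin> B"
  shows "Poly_Mapping.lookup p m = Poly_Mapping.lookup q m"
proof -
  interpret ideal "monomial_span B" "poly_ring_upto n :: 'k mpoly ring" by fact
  have "p \<in> monomial_span B +>\<^bsub>poly_ring_upto n\<^esub> q"
    using a_rcos_self[of p] assms by simp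
  then obtain x where "x \<in> monomial_span B" "p = x + q"
    by (auto simp: a_r_coset_def r_coset_def)
  then show ?thesis
    using assms(4) by (auto simp: monomial_span_def lookup_add in_keys_iff)
qed

text \<open>Terms with monomial in \<open>B\<close> become zero in the quotient, so they can be
  deleted from a representative one at a time. This gives the spanning half of the basis
  claim.\<close>

lemma quotient_image_drop_ideal:
  assumes ideal: "ideal (monomial_span B) (poly_ring_upto n :: 'k::field mpoly ring)"
    and D: "D \<subseteq> monomials n"
  shows "quotient_image n (monomial_span B) (monomial_span D) =
    quotient_image n (monomial_span B :: 'k mpoly set) (monomial_span (D - B))"
proof
  interpret ideal "monomial_span B" "poly_ring_upto n :: 'k mpoly ring" by (rule ideal)
  interpret h: ring_hom_ring "poly_ring_upto n :: 'k mpoly ring"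
    "poly_ring_upto n Quot monomial_span B" "(+>\<^bsub>poly_ring_upto n\<^esub>) (monomial_span B)"
    by (rule rcos_ring_hom_ring)
  let ?h = "(+>\<^bsub>poly_ring_upto n\<^esub>) (monomial_span B :: 'k mpoly set)"
  have hadd: "?h (p + q) = ?h p \<oplus>\<^bsub>poly_ring_upto n Quot monomial_span B\<^esub> ?h q"
    if "p \<in> monomial_span D" "q \<in> monomial_span D" for p q :: "'k mpoly"
    using h.hom_add[of p q] that D by (auto simp: monomial_span_def)
  show "quotient_image n (monomial_span B) (monomial_span D) \<subseteq>
      quotient_image n (monomial_span B :: 'k mpoly set) (monomial_span (D - B))"
    unfolding quotient_image_def
  proof (rule image_subsetI)
    fix p :: "'k mpoly"
    assume "p \<in> monomial_span D"
    then show "?h p \<in> ?h ` monomial_span (D - B)"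
    proof (induction rule: monomial_span_induct)
      case zero
      then show ?case using zero_in_monomial_span by blast
    next
      case (add m c q)
      then obtain q' where q': "?h q = ?h q'" "q' \<in> monomial_span (D - B)" by blast
      then have q'D: "q' \<in> monomial_span D"
        using monomial_span_mono[of "D - B" D] by blast
      have mD: "Poly_Mapping.single m c \<in> monomial_span D"
        using add by (simp add: single_in_monomial_span)
      then have eq: "?h (Poly_Mapping.single m c + q) = ?h (Poly_Mapping.single m c + q')"
        using hadd q' q'D add by simp
      show ?case
      proof (cases "m \<in> B")
        case False
        then show ?thesis
          unfolding eq using q' add by (intro imageI monomial_span_add single_in_monomial_span) auto
      next
        case True
        then have "?h (Poly_Mapping.single m c) = monomial_span B"
          by (intro a_rcos_const single_in_monomial_span)
        then have "?h (Poly_Mapping.single m c) = \<zero>\<^bsub>poly_ring_upto n Quot monomial_span B\<^esub>"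
          by (simp add: FactRing_def)
        moreover have "?h q' \<in> carrier (poly_ring_upto n Quot monomial_span B)"
          using h.hom_closed q'D D by (auto simp: monomial_span_def)
        ultimately have "?h (Poly_Mapping.single m c + q) = ?h q'"
          using hadd[OF mD q'D] eq h.S.l_zero by simp
        then show ?thesis using q' by blast
      qed
    qed
  qed
  show "quotient_image n (monomial_span B :: 'k mpoly set) (monomial_span (D - B)) \<subseteq>
      quotient_image n (monomial_span B) (monomial_span D)"
    unfolding quotient_image_def by (intro image_mono monomial_span_mono) auto
qed

text \<open>A ring homomorphism maps a field onto a field as soon as the target is not the zero
  ring. The exponent function \<open>0\<close> is the monomial 1, so \<open>0 \<notin> B\<close>
  says that the ideal is proper.\<close>

lemma subfield_quotient_const:
  assumes "ideal (monomial_span B) (poly_ring_upto n :: 'k::field mpoly ring)" and "0 \<notin> B"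
  shows "subfield (quotient_image n (monomial_span B :: 'k mpoly set) (range const_poly))
    (poly_ring_upto n Quot monomial_span B)"
proof -
  interpret ideal "monomial_span B" "poly_ring_upto n :: 'k mpoly ring" by fact
  interpret h: ring_hom_ring "poly_ring_upto n :: 'k mpoly ring"
    "poly_ring_upto n Quot monomial_span B" "(+>\<^bsub>poly_ring_upto n\<^esub>) (monomial_span B)"
    by (rule rcos_ring_hom_ring)
  have "\<one>\<^bsub>poly_ring_upto n Quot monomial_span B\<^esub> \<noteq> \<zero>\<^bsub>poly_ring_upto n Quot (monomial_span B :: 'k mpoly set)\<^esub>"
  proof
    assume "\<one>\<^bsub>poly_ring_upto n Quot monomial_span B\<^esub> = \<zero>\<^bsub>poly_ring_upto n Quot (monomial_span B :: 'k mpoly set)\<^esub>"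
    then have "(1 :: 'k mpoly) \<in> monomial_span B"
      using a_rcos_self[of 1] by (auto simp: FactRing_def monomials_def)
    then show False using assms(2) by (simp add: monomial_span_def)
  qed
  then show ?thesis
    unfolding quotient_image_def using h.img_is_subfield(2)[OF subfield_const_poly] by blast
qed

text \<open>Adjoining one standard monomial at a time raises the dimension by one each time, because
  its coset is not in the span of the earlier ones.\<close>

lemma dimension_quotient_monomial_span:
  assumes ideal: "ideal (monomial_span B) (poly_ring_upto n :: 'k::field mpoly ring)"
    and "finite M" "M \<subseteq> monomials n - B"
  shows "ring.dimension (poly_ring_upto n Quot monomial_span B) (card M)
    (quotient_image n (monomial_span B :: 'k mpoly set) (range const_poly))
    (quotient_image n (monomial_span B) (monomial_span M))"
  using assms(2,3)
proof (induction M rule: finite_induct)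
  interpret ideal "monomial_span B" "poly_ring_upto n :: 'k mpoly ring" by (rule ideal)
  interpret h: ring_hom_ring "poly_ring_upto n :: 'k mpoly ring"
    "poly_ring_upto n Quot monomial_span B" "(+>\<^bsub>poly_ring_upto n\<^esub>) (monomial_span B)"
    by (rule rcos_ring_hom_ring)
  let ?h = "(+>\<^bsub>poly_ring_upto n\<^esub>) (monomial_span B :: 'k mpoly set)"
  let ?A = "poly_ring_upto n Quot (monomial_span B :: 'k mpoly set)"
  {
    case empty
    have "monomial_span {} = {0 :: 'k mpoly}"
      by (auto simp: monomial_span_def)
    then have "quotient_image n (monomial_span B :: 'k mpoly set) (monomial_span {}) = {\<zero>\<^bsub>?A\<^esub>}"
      using h.hom_zero by (simp add: quotient_image_def)
    then show ?case by simp
  next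
    case (insert m M)
    let ?K = "quotient_image n (monomial_span B :: 'k mpoly set) (range const_poly)"
    let ?E = "quotient_image n (monomial_span B :: 'k mpoly set) (monomial_span M)"
    define v where "v = ?h (monom_poly m)"
    have mc: "monom_poly m \<in> carrier (poly_ring_upto n :: 'k mpoly ring)"
      using insert.prems by (simp add: monom_poly_def)
    have Mc: "monomial_span M \<subseteq> carrier (poly_ring_upto n :: 'k mpoly ring)"
      using insert.prems by (auto simp: monomial_span_def)
    have "v \<in> carrier ?A"
      unfolding v_def using mc by (rule h.hom_closed)
    \<comment> \<open>Since \<open>m\<close> lies outside \<open>B\<close>, its coefficient is
      determined by the coset: it is 1 in \<open>monom_poly m\<close>, but 0 in any \<open>q\<close>
      supported on \<open>M\<close>.\<close>
    moreover have "v \<notin> ?E"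
    proof
      assume "v \<in> ?E"
      then obtain q where q: "q \<in> monomial_span M" "v = ?h q"
        by (auto simp: quotient_image_def)
      then have "Poly_Mapping.lookup (monom_poly m :: 'k mpoly) m = Poly_Mapping.lookup q m"
        using insert.prems q by (intro coset_eq_imp_lookup_eq[OF ideal mc]) (auto simp: v_def)
      moreover have "m \<notin> Poly_Mapping.keys q"
        using q(1) insert.hyps(2) by (auto simp: monomial_span_def)
      ultimately show False
        by (simp add: monom_poly_def in_keys_iff)
    qed
    ultimately have "h.S.dimension (Suc (card M)) ?K (h.S.line_extension ?K v ?E)"
      using insert.prems by (intro h.S.dimension.Suc_dim insert.IH) auto
    moreover have "h.S.line_extension ?K v ?E =
        quotient_image n (monomial_span B) (monomial_span (insert m M))"
    proof -
      \<comment> \<open>Elements of the line extension are scalar times \<open>v\<close> plus an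
        element of the old space; this rewrites them as cosets of a term at \<open>m\<close> plus a
        polynomial on \<open>M\<close>, which is how the polynomials on \<open>insert m M\<close>
        decompose.\<close>
      have step: "?h (const_poly c) \<otimes>\<^bsub>?A\<^esub> v \<oplus>\<^bsub>?A\<^esub> ?h q = ?h (Poly_Mapping.single m c + q)"
        if "q \<in> monomial_span M" for c q
      proof -
        have cc: "const_poly c \<in> carrier (poly_ring_upto n :: 'k mpoly ring)"
          by (simp add: const_poly_def monomials_def)
        have "?h (const_poly c) \<otimes>\<^bsub>?A\<^esub> v = ?h (Poly_Mapping.single m c)"
          using h.hom_mult[OF cc mc] by (simp add: v_def const_poly_def monom_poly_def mult_single)
        moreover have "Poly_Mapping.single m c \<in> carrier (poly_ring_upto n :: 'k mpoly ring)"
          using insert.prems by simp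
        ultimately show ?thesis
          using h.hom_add[of "Poly_Mapping.single m c" q] that Mc by auto
      qed
      show ?thesis
      proof (intro equalityI subsetI)
        fix u
        assume "u \<in> h.S.line_extension ?K v ?E"
        then obtain c q where "q \<in> monomial_span M" "u = ?h (Poly_Mapping.single m c + q)"
          unfolding quotient_image_def h.S.line_extension_mem_iff using step by auto
        moreover from this have "Poly_Mapping.single m c + q \<in> monomial_span (insert m M)"
          using monomial_span_mono[of M "insert m M"]
          by (intro monomial_span_add single_in_monomial_span) auto
        ultimately show "u \<in> quotient_image n (monomial_span B) (monomial_span (insert m M))"
          by (auto simp: quotient_image_def)
      next
        fix u
        assume "u \<in> quotient_image n (monomial_span B :: 'k mpoly set) (monomial_span (insert m M))"
        then obtain p where "p \<in> monomial_span (insert m M)" "u = ?h p"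
          by (auto simp: quotient_image_def)
        then obtain c q where "q \<in> monomial_span M" "u = ?h (Poly_Mapping.single m c + q)"
          using monomial_span_insert by metis
        then show "u \<in> h.S.line_extension ?K v ?E"
          unfolding quotient_image_def h.S.line_extension_mem_iff using step by auto
      qed
    qed
    ultimately show ?case
      using insert.hyps by simp
  }
qed

lemma quotient_HS_monomial_ideal:
  fixes B :: "monomial set"
  assumes ideal: "ideal (monomial_span B) (poly_ring_upto n :: 'k::field mpoly ring)"
    and "0 \<notin> B" and fin: "finite {m \<in> monomials n - B. mdeg m = d}"
  shows "fps_nth (quotient_HS n (monomial_span B :: 'k mpoly set)) d =
    int (card {m \<in> monomials n - B. mdeg m = d})"
proof -
  interpret A: ring "poly_ring_upto n Quot (monomial_span B :: 'k mpoly set)"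
    using ideal by (rule ideal.quotient_is_ring)
  have "homogeneous_part n d = (monomial_span {m \<in> monomials n. mdeg m = d} :: 'k mpoly set)"
    by (auto simp: homogeneous_part_def monomial_span_def)
  moreover have "{m \<in> monomials n. mdeg m = d} - B = {m \<in> monomials n - B. mdeg m = d}"
    by blast
  ultimately have "quotient_image n (monomial_span B) (homogeneous_part n d) =
      quotient_image n (monomial_span B :: 'k mpoly set) (monomial_span {m \<in> monomials n - B. mdeg m = d})"
    using quotient_image_drop_ideal[OF ideal, of "{m \<in> monomials n. mdeg m = d}"] by auto
  moreover have "A.dimension (card {m \<in> monomials n - B. mdeg m = d})
    (quotient_image n (monomial_span B :: 'k mpoly set) (range const_poly))
    (quotient_image n (monomial_span B) (monomial_span {m \<in> monomials n - B. mdeg m = d}))"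
    by (rule dimension_quotient_monomial_span[OF ideal fin]) auto
  ultimately show ?thesis
    \<comment> \<open>Over a subfield the dimension is unique, so the relation
      \<open>dimension\<close> fixes the value of \<open>dim\<close>; finiteness of the set of
      standard monomials rules out the unspecified case.\<close>
    using A.dimI[OF subfield_quotient_const[OF ideal \<open>0 \<notin> B\<close>]]
    by (simp add: quotient_HS_def hilbert_series_def over_def)
qed

section \<open>Square-free monomial ideals together with the squares of the variables\<close>

text \<open>The square-free monomial \<open>x_S\<close>. It reduces divisibility to inclusion of
  sets and degree to cardinality.\<close>

definition support_monomial :: "nat set \<Rightarrow> monomial"
  where "support_monomial S = (\<Sum>l\<in>S. var_mon l)"

lemma lookup_support_monomial:
  assumes "finite S"
  shows "Poly_Mapping.lookup (support_monomial S) l = of_bool (l \<in> S)"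
  using assms by (induction S) (auto simp: support_monomial_def var_mon_def lookup_add lookup_single when_def)

lemma keys_support_monomial:
  assumes "finite S"
  shows "Poly_Mapping.keys (support_monomial S) = S"
  using assms by (auto simp: in_keys_iff lookup_support_monomial)

lemma mdeg_support_monomial:
  assumes "finite S"
  shows "mdeg (support_monomial S) = card S"
  using assms by (simp add: mdeg_def keys_support_monomial lookup_support_monomial)

lemma support_monomial_in_monomials:
  assumes "finite S"
  shows "support_monomial S \<in> monomials n \<longleftrightarrow> S \<subseteq> {1..n}"
  using assms by (simp add: monomials_def keys_support_monomial)

lemma support_monomial_pair: "a \<noteq> b \<Longrightarrow> support_monomial {a, b} = var_mon a + var_mon b"
  by (simp add: support_monomial_def)

lemma support_monomial_dvd_iff:
  assumes "finite S"
  shows "(\<exists>c. m = support_monomial S + c) \<longleftrightarrow> S \<subseteq> Poly_Mapping.keys m"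
proof -
  have "(of_bool P \<le> x) \<longleftrightarrow> (P \<longrightarrow> x \<noteq> 0)" for P and x :: nat by auto
  then show ?thesis
    unfolding monomial_dvd_iff lookup_support_monomial[OF assms] by (auto simp: in_keys_iff)
qed

lemma squarefree_monomial_eq_support:
  assumes "squarefree_monomial m"
  shows "support_monomial (Poly_Mapping.keys m) = m"
proof (rule poly_mapping_eqI)
  fix l
  have "Poly_Mapping.lookup m l \<le> 1"
    using assms by (simp add: squarefree_monomial_def)
  then show "Poly_Mapping.lookup (support_monomial (Poly_Mapping.keys m)) l = Poly_Mapping.lookup m l"
    by (auto simp: lookup_support_monomial in_keys_iff)
qed

lemma squarefree_support_monomial: "finite S \<Longrightarrow> squarefree_monomial (support_monomial S)"
  by (simp add: squarefree_monomial_def lookup_support_monomial)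

text \<open>Avoiding all multiples of the squares means being square-free, hence being determined by
  the support; divisibility by a square-free generator is then inclusion of supports.\<close>

lemma standard_monomials_squares_plus_squarefree:
  assumes F: "\<And>T. T \<in> F \<Longrightarrow> finite T"
  shows "monomials n - monomial_multiples n ((\<lambda>l. Poly_Mapping.single l 2) ` {1..n} \<union> support_monomial ` F) =
    support_monomial ` {S. S \<subseteq> {1..n} \<and> (\<forall>T\<in>F. \<not> T \<subseteq> S)}"
proof -
  have square: "(\<exists>c. m = Poly_Mapping.single l 2 + c) \<longleftrightarrow> 2 \<le> Poly_Mapping.lookup m l" for m :: monomial and l
    unfolding monomial_dvd_iff by (auto simp: lookup_single when_def)
  have standard_iff: "m \<in> monomials n - monomial_multiples n ((\<lambda>l. Poly_Mapping.single l 2) ` {1..n} \<union> support_monomial ` F)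
      \<longleftrightarrow> squarefree_monomial m \<and> Poly_Mapping.keys m \<subseteq> {1..n} \<and> (\<forall>T\<in>F. \<not> T \<subseteq> Poly_Mapping.keys m)" for m
  proof -
    \<comment> \<open>Square-freeness speaks of all indices, the squares only of
      \<open>1..n\<close>; the two agree because the support of \<open>m\<close> lies in
      \<open>1..n\<close>.\<close>
    have "(\<forall>l\<in>{1..n}. \<not> 2 \<le> Poly_Mapping.lookup m l) \<longleftrightarrow> squarefree_monomial m"
      if "Poly_Mapping.keys m \<subseteq> {1..n}"
    proof
      assume *: "\<forall>l\<in>{1..n}. \<not> 2 \<le> Poly_Mapping.lookup m l"
      have "Poly_Mapping.lookup m l \<le> 1" for l
      proof (cases "l \<in> Poly_Mapping.keys m")
        case True
        then show ?thesis using * that by force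
      qed (simp add: in_keys_iff)
      then show "squarefree_monomial m" by (simp add: squarefree_monomial_def)
    next
      assume "squarefree_monomial m"
      then have "Poly_Mapping.lookup m l \<le> 1" for l
        by (simp add: squarefree_monomial_def)
      from le_less_trans[OF this] show "\<forall>l\<in>{1..n}. \<not> 2 \<le> Poly_Mapping.lookup m l"
        by (simp add: not_le)
    qed
    moreover have "(\<exists>c. m = support_monomial T + c) \<longleftrightarrow> T \<subseteq> Poly_Mapping.keys m" if "T \<in> F" for T
      using support_monomial_dvd_iff[OF F[OF that]] .
    ultimately show ?thesis
      by (simp add: monomial_multiples_def monomials_def bex_Un square) blast
  qed
  have support_iff: "squarefree_monomial m \<and> Poly_Mapping.keys m \<subseteq> {1..n} \<and> (\<forall>T\<in>F. \<not> T \<subseteq> Poly_Mapping.keys m)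
      \<longleftrightarrow> m \<in> support_monomial ` {S. S \<subseteq> {1..n} \<and> (\<forall>T\<in>F. \<not> T \<subseteq> S)}" for m
  proof
    assume "squarefree_monomial m \<and> Poly_Mapping.keys m \<subseteq> {1..n} \<and> (\<forall>T\<in>F. \<not> T \<subseteq> Poly_Mapping.keys m)"
    then show "m \<in> support_monomial ` {S. S \<subseteq> {1..n} \<and> (\<forall>T\<in>F. \<not> T \<subseteq> S)}"
      using squarefree_monomial_eq_support[of m] by (intro image_eqI[of _ _ "Poly_Mapping.keys m"]) auto
  next
    assume "m \<in> support_monomial ` {S. S \<subseteq> {1..n} \<and> (\<forall>T\<in>F. \<not> T \<subseteq> S)}"
    then obtain S where S: "m = support_monomial S" "S \<subseteq> {1..n}" "\<forall>T\<in>F. \<not> T \<subseteq> S"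
      by blast
    moreover from S have "finite S" using finite_subset by blast
    ultimately show "squarefree_monomial m \<and> Poly_Mapping.keys m \<subseteq> {1..n} \<and> (\<forall>T\<in>F. \<not> T \<subseteq> Poly_Mapping.keys m)"
      by (simp add: squarefree_support_monomial keys_support_monomial)
  qed
  show ?thesis
    by (rule Set.set_eqI) (rule trans[OF standard_iff support_iff])
qed

lemma sum_monomials_nth:
  assumes "finite A"
  shows "fps_nth (\<Sum>S\<in>A. fps_X ^ f S :: 'a::comm_ring_1 fps) d = of_nat (card {S \<in> A. f S = d})"
proof -
  have "fps_nth (\<Sum>S\<in>A. fps_X ^ f S :: 'a fps) d = (\<Sum>S\<in>A. if f S = d then 1 else 0)"
    by (auto simp: fps_sum_nth intro!: sum.cong)
  also have "\<dots> = of_nat (card {S \<in> A. f S = d})"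
    using assms by (simp add: sum.If_cases Int_def)
  finally show ?thesis .
qed

text \<open>Compare coefficients: in degree \<open>d\<close> both sides count the admissible
  supports of size \<open>d\<close>. The condition \<open>{} \<notin> F\<close> keeps the monomial 1
  out of the ideal.\<close>

lemma quotient_HS_squares_plus_squarefree:
  assumes F: "\<And>T. T \<in> F \<Longrightarrow> finite T" "{} \<notin> F"
  and B_def: "B = monomial_multiples n ((\<lambda>l. Poly_Mapping.single l 2) ` {1..n} \<union> support_monomial ` F)"
  shows "quotient_HS n (monomial_span B :: 'k::field mpoly set) =
    (\<Sum>S | S \<subseteq> {1..n} \<and> (\<forall>T\<in>F. \<not> T \<subseteq> S). fps_X ^ card S)"
proof (rule fps_ext)
  fix d
  let ?A = "{S. S \<subseteq> {1..n} \<and> (\<forall>T\<in>F. \<not> T \<subseteq> S)}"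
  have fin: "finite ?A" by simp
  have finS: "finite S" if "S \<in> ?A" for S
    using that finite_subset by blast
  have std: "monomials n - B = support_monomial ` ?A"
    unfolding B_def using F(1) by (rule standard_monomials_squares_plus_squarefree)
  have eq: "{m \<in> monomials n - B. mdeg m = d} = support_monomial ` {S \<in> ?A. card S = d}"
    unfolding std using mdeg_support_monomial[OF finS] by auto
  have "{} \<in> ?A" using F(2) by auto
  then have "support_monomial {} \<in> monomials n - B" unfolding std by (rule imageI)
  then have zero: "0 \<notin> B" by (simp add: support_monomial_def)
  have "inj_on support_monomial {S \<in> ?A. card S = d}"
    by (rule inj_on_inverseI[of _ Poly_Mapping.keys]) (use keys_support_monomial[OF finS] in auto)
  then have "card {m \<in> monomials n - B. mdeg m = d} = card {S \<in> ?A. card S = d}"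
    unfolding eq by (rule card_image)
  moreover have "fps_nth (quotient_HS n (monomial_span B :: 'k mpoly set)) d =
      int (card {m \<in> monomials n - B. mdeg m = d})"
  proof (rule quotient_HS_monomial_ideal[OF _ zero])
    show "ideal (monomial_span B :: 'k mpoly set) (poly_ring_upto n)"
      unfolding B_def by (rule ideal_monomial_multiples)
    show "finite {m \<in> monomials n - B. mdeg m = d}"
      unfolding eq using fin by simp
  qed
  ultimately show "fps_nth (quotient_HS n (monomial_span B :: 'k mpoly set)) d =
      fps_nth (\<Sum>S\<in>?A. fps_X ^ card S) d"
    unfolding sum_monomials_nth[OF fin] by simp
qed


section \<open>Reverse lexicographic segments\<close>

text \<open>Both monomials have degree 2 and exponents 0 or 1, so the order asks that the largest
  index in which the two supports differ belong to \<open>{i, j}\<close>.\<close>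

lemma revlex_greater_pair_iff:
  assumes "a < b" "i < j"
  shows "revlex_greater (support_monomial {a, b}) (support_monomial {i, j}) \<longleftrightarrow> b < j \<or> b = j \<and> a < i"
proof -
  have of_bool_less: "int (of_bool P) - int (of_bool Q) < 0 \<longleftrightarrow> \<not> P \<and> Q" for P Q
    by auto
  have "revlex_greater (support_monomial {a, b}) (support_monomial {i, j}) \<longleftrightarrow>
      (\<exists>l. l \<notin> {a, b} \<and> l \<in> {i, j} \<and> (\<forall>l'>l. l' \<in> {a, b} \<longleftrightarrow> l' \<in> {i, j}))"
    using assms unfolding revlex_greater_def
    by (simp only: mdeg_support_monomial lookup_support_monomial finite.intros of_bool_less of_bool_eq_iff) simp
  also have "\<dots> \<longleftrightarrow> b < j \<or> b = j \<and> a < i"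
  proof
    assume "\<exists>l. l \<notin> {a, b} \<and> l \<in> {i, j} \<and> (\<forall>l'>l. l' \<in> {a, b} \<longleftrightarrow> l' \<in> {i, j})"
    then obtain l where l: "l \<notin> {a, b}" "l \<in> {i, j}" and above: "\<And>l'. l' > l \<Longrightarrow> l' \<in> {a, b} \<longleftrightarrow> l' \<in> {i, j}"
      by blast
    \<comment> \<open>If \<open>l = j\<close>, neither support goes beyond \<open>j\<close>, so
      \<open>b < j\<close>. If \<open>l = i\<close>, agreement above \<open>i\<close> forces
      \<open>b = j\<close>, and then \<open>a < i\<close>.\<close>
    show "b < j \<or> b = j \<and> a < i"
      using l above[of a] above[of b] above[of j] assms linorder_less_linear[of a i] by auto
  next
    assume "b < j \<or> b = j \<and> a < i"
    then show "\<exists>l. l \<notin> {a, b} \<and> l \<in> {i, j} \<and> (\<forall>l'>l. l' \<in> {a, b} \<longleftrightarrow> l' \<in> {i, j})"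
    proof
      assume "b < j"
      then show ?thesis using assms by (intro exI[of _ j]) auto
    next
      assume "b = j \<and> a < i"
      then show ?thesis using assms by (intro exI[of _ i]) auto
    qed
  qed
  finally show ?thesis .
qed

definition revlex_pairs :: "nat \<Rightarrow> nat \<Rightarrow> nat \<Rightarrow> nat set set"
  where "revlex_pairs n i j = {{a, b} | a b. 1 \<le> a \<and> a < b \<and> b \<le> n \<and> (b < j \<or> b = j \<and> a \<le> i)}"

text \<open>A square-free monomial of degree 2 is \<open>x_a x_b\<close> with \<open>a < b\<close>.
  The strict order contributes \<open>a < i\<close> in the case \<open>b = j\<close>, and equality
  with \<open>x_i x_j\<close> adds \<open>a = i\<close>.\<close>

lemma RLex_generators:
  assumes "i < j"
  shows "{m \<in> monomials n. squarefree_monomial m \<and> mdeg m = 2 \<and>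
      (revlex_greater m (var_mon i + var_mon j) \<or> m = var_mon i + var_mon j)} =
    support_monomial ` revlex_pairs n i j"
proof -
  have ij: "var_mon i + var_mon j = support_monomial {i, j}"
    using assms by (simp add: support_monomial_pair)
  have pair: "revlex_greater (support_monomial {a, b}) (support_monomial {i, j}) \<or>
      support_monomial {a, b} = support_monomial {i, j} \<longleftrightarrow> b < j \<or> b = j \<and> a \<le> i" if "a < b" for a b
  proof -
    have "support_monomial {a, b} = support_monomial {i, j} \<longleftrightarrow> {a, b} = {i, j}"
      by (metis finite.intros keys_support_monomial)
    also have "\<dots> \<longleftrightarrow> a = i \<and> b = j"
      using that assms by (auto simp: doubleton_eq_iff)
    finally show ?thesis
      using revlex_greater_pair_iff[OF that assms] by auto
  qed
  show ?thesis
    unfolding ij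
  proof (intro equalityI subsetI)
    fix m
    assume "m \<in> {m \<in> monomials n. squarefree_monomial m \<and> mdeg m = 2 \<and>
      (revlex_greater m (support_monomial {i, j}) \<or> m = support_monomial {i, j})}"
    then have m: "m \<in> monomials n" "squarefree_monomial m" "mdeg m = 2"
      "revlex_greater m (support_monomial {i, j}) \<or> m = support_monomial {i, j}" by auto
    let ?S = "Poly_Mapping.keys m"
    have mS: "m = support_monomial ?S"
      using m(2) by (simp add: squarefree_monomial_eq_support)
    then have "card ?S = 2"
      using m(3) mdeg_support_monomial[of ?S] by simp
    then obtain x y where "?S = {x, y}" "x \<noteq> y"
      by (auto simp: card_2_iff)
    then obtain a b where ab: "?S = {a, b}" "a < b"
      by (metis insert_commute nat_neq_iff)
    then have "b < j \<or> b = j \<and> a \<le> i"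
      using pair[OF ab(2)] m(4) mS by simp
    moreover have "1 \<le> a" "b \<le> n"
      using m(1) ab by (auto simp: monomials_def)
    ultimately show "m \<in> support_monomial ` revlex_pairs n i j"
      using mS ab unfolding revlex_pairs_def by auto
  next
    fix m
    assume "m \<in> support_monomial ` revlex_pairs n i j"
    then obtain a b where ab: "m = support_monomial {a, b}" "1 \<le> a" "a < b" "b \<le> n" "b < j \<or> b = j \<and> a \<le> i"
      by (auto simp: revlex_pairs_def)
    then show "m \<in> {m \<in> monomials n. squarefree_monomial m \<and> mdeg m = 2 \<and>
      (revlex_greater m (support_monomial {i, j}) \<or> m = support_monomial {i, j})}"
      using pair[OF ab(3)]
      by (auto simp: support_monomial_in_monomials squarefree_support_monomial mdeg_support_monomial)
  qed
qed

section \<open>Generating function of the supports that contain no generating pair\<close>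

text \<open>Expanding the product of \<open>card A\<close> factors \<open>1 + X\<close> chooses a
  subset of \<open>A\<close>.\<close>

lemma sum_Pow_fps_X:
  assumes "finite A"
  shows "(\<Sum>U\<in>Pow A. fps_X ^ card U) = ((1 + fps_X) ^ card A :: 'a::comm_ring_1 fps)"
  using prod_add[OF assms, of "\<lambda>_. fps_X :: 'a fps" "\<lambda>_. 1"] by (simp add: add.commute)

lemma revlex_pairs_avoiding:
  assumes "1 \<le> i" "i < j" "j \<le> n"
  shows "{S. S \<subseteq> {1..n} \<and> (\<forall>T\<in>revlex_pairs n i j. \<not> T \<subseteq> S)} =
    (\<lambda>(T, U). T \<union> U) ` (({{}} \<union> (\<lambda>a. {a}) ` {1..j} \<union> (\<lambda>a. {a, j}) ` {i<..<j}) \<times> Pow {j<..n})"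
    (is "?L = (\<lambda>(T, U). T \<union> U) ` (?T \<times> _)")
proof (intro equalityI subsetI)
  fix S
  assume "S \<in> ?L"
  then have S: "S \<subseteq> {1..n}" and notin: "\<And>T. T \<in> revlex_pairs n i j \<Longrightarrow> \<not> T \<subseteq> S" by auto
  \<comment> \<open>What avoidance says of two elements \<open>a < b\<close> of \<open>S\<close>:
    the larger is at least \<open>j\<close>, and if it equals \<open>j\<close>, the smaller exceeds
    \<open>i\<close>.\<close>
  have avoid: "j \<le> b \<and> (b = j \<longrightarrow> i < a)" if "a \<in> S" "b \<in> S" "a < b" for a b
  proof -
    have "1 \<le> a" "b \<le> n" using S that by auto
    moreover have "{a, b} \<notin> revlex_pairs n i j" using notin[of "{a, b}"] that by auto
    ultimately have "\<not> (b < j \<or> b = j \<and> a \<le> i)" using that unfolding revlex_pairs_def by blast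
    then show ?thesis by auto
  qed
  have "S \<inter> {1..j} \<in> ?T"
  proof (cases "\<exists>x\<in>S. x < j")
    case True
    then obtain x where x: "x \<in> S" "x < j" by blast
    \<comment> \<open>Two distinct elements below \<open>j\<close> would form a forbidden pair, so
      \<open>x\<close> is the only one, and at most \<open>j\<close> can join it.\<close>
    have "y = x" if "y \<in> S" "y < j" for y
      using x that avoid[of x y] avoid[of y x] by linarith
    then have "S \<inter> {1..j} \<subseteq> {x, j}" by force
    moreover have "x \<in> S \<inter> {1..j}" using x S by auto
    ultimately have "S \<inter> {1..j} = {x} \<or> j \<in> S \<and> S \<inter> {1..j} = {x, j}" by blast
    then show ?thesis
    proof
      assume "S \<inter> {1..j} = {x}"
      moreover have "x \<in> {1..j}" using x S by auto
      ultimately show ?thesis by blast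
    next
      assume "j \<in> S \<and> S \<inter> {1..j} = {x, j}"
      moreover from this have "x \<in> {i<..<j}" using avoid[of x j] x by auto
      ultimately show ?thesis by blast
    qed
  next
    case False
    then have "S \<inter> {1..j} = {} \<or> S \<inter> {1..j} = {j}" by force
    \<comment> \<open>The set \<open>{j}\<close> is counted among the singletons, whose index range
      therefore includes \<open>j\<close>.\<close>
    moreover have "{j} \<in> ?T" using assms by (intro UnI1 UnI2 image_eqI[of _ _ j]) auto
    moreover have "{} \<in> ?T" by simp
    ultimately show ?thesis by metis
  qed
  moreover have "S = S \<inter> {1..j} \<union> S \<inter> {j<..n}" using S by force
  ultimately show "S \<in> (\<lambda>(T, U). T \<union> U) ` (?T \<times> Pow {j<..n})"
    by (intro image_eqI[of _ _ "(S \<inter> {1..j}, S \<inter> {j<..n})"]) auto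
next
  fix S
  assume "S \<in> (\<lambda>(T, U). T \<union> U) ` (?T \<times> Pow {j<..n})"
  then obtain T U where S: "S = T \<union> U" and T: "T \<in> ?T" and U: "U \<subseteq> {j<..n}"
    by auto
  have "T \<subseteq> {1..j}" using T assms by auto
  then have "S \<subseteq> {1..n}" using S U assms by fastforce
  moreover have "\<not> {a, b} \<subseteq> S" if "a < b" "b < j \<or> b = j \<and> a \<le> i" for a b
  proof
    assume "{a, b} \<subseteq> S"
    \<comment> \<open>A forbidden pair has both elements at most \<open>j\<close>, so it cannot use
      \<open>U\<close>; and the only two-element choices of \<open>T\<close> are
      \<open>{a, j}\<close> with \<open>a > i\<close>.\<close>
    then have "a \<in> T" "b \<in> T" using S U that by auto
    then show False using T that assms by auto
  qed
  ultimately show "S \<in> ?L"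
    by (auto simp: revlex_pairs_def simp del: insert_subset)
qed

text \<open>The sum factors over the independent choices of \<open>T\<close> and \<open>U\<close>.
  The choices of \<open>T\<close> are the empty set, \<open>j\<close> singletons and
  \<open>j - i - 1\<close> pairs, which give the quadratic factor.\<close>

lemma sum_revlex_pairs_avoiding:
  assumes "1 \<le> i" "i < j" "j \<le> n"
  shows "(\<Sum>S | S \<subseteq> {1..n} \<and> (\<forall>T\<in>revlex_pairs n i j. \<not> T \<subseteq> S). fps_X ^ card S) =
    ((1 + fps_X) ^ (n - j) *
      (1 + fps_const (int j) * fps_X + fps_const (int j - int i - 1) * fps_X ^ 2))"
proof -
  define T1 T2 where "T1 = (\<lambda>a. {a}) ` {1..j}" and "T2 = (\<lambda>a. {a, j}) ` {i<..<j}"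
  let ?T = "{{}} \<union> T1 \<union> T2"
  have le: "T \<subseteq> {1..j}" if "T \<in> ?T" for T
    using that assms by (auto simp: T1_def T2_def)
  have inj: "inj_on (\<lambda>(T, U). T \<union> U) (?T \<times> Pow {j<..n})"
  \<comment> \<open>Cutting the union at \<open>j\<close> recovers both parts.\<close>
  proof (rule inj_on_inverseI[of _ "\<lambda>S. (S \<inter> {..j}, S \<inter> {j<..})"])
    fix p
    assume "p \<in> ?T \<times> Pow {j<..n}"
    then obtain T U where p: "p = (T, U)" "T \<subseteq> {1..j}" "U \<subseteq> {j<..n}"
      using le by blast
    then have "(T \<union> U) \<inter> {..j} = T" "(T \<union> U) \<inter> {j<..} = U" by force+
    then show "((case p of (T, U) \<Rightarrow> T \<union> U) \<inter> {..j}, (case p of (T, U) \<Rightarrow> T \<union> U) \<inter> {j<..}) = p"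
      by (simp add: p)
  qed
  have card: "card (T \<union> U) = card T + card U" if "T \<in> ?T" "U \<in> Pow {j<..n}" for T U
  proof (rule card_Un_disjoint)
    have T: "T \<subseteq> {1..j}" and U: "U \<subseteq> {j<..n}" using le that by auto
    then show "finite T" "finite U" using finite_subset by blast+
    show "T \<inter> U = {}" using T U by force
  qed
  have "(\<Sum>S | S \<subseteq> {1..n} \<and> (\<forall>T\<in>revlex_pairs n i j. \<not> T \<subseteq> S). fps_X ^ card S :: int fps) =
      (\<Sum>(T, U)\<in>?T \<times> Pow {j<..n}. fps_X ^ card (T \<union> U))"
    unfolding revlex_pairs_avoiding[OF assms, folded T1_def T2_def]
    by (subst sum.reindex[OF inj]) (simp add: case_prod_unfold)
  also have "\<dots> = (\<Sum>T\<in>?T. \<Sum>U\<in>Pow {j<..n}. fps_X ^ card T * fps_X ^ card U)"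
    unfolding sum.cartesian_product using card by (intro sum.cong) (auto simp: power_add)
  also have "\<dots> = (\<Sum>T\<in>?T. fps_X ^ card T) * (1 + fps_X) ^ (n - j)"
    by (simp add: sum_product[symmetric] sum_Pow_fps_X del: sum.insert)
  also have "(\<Sum>T\<in>?T. fps_X ^ card T :: int fps) =
      1 + fps_const (int j) * fps_X + fps_const (int j - int i - 1) * fps_X ^ 2"
  proof -
    have "(\<Sum>T\<in>T1. fps_X ^ card T :: int fps) = of_nat j * fps_X"
      unfolding T1_def by (subst sum.reindex) auto
    moreover have "(\<Sum>T\<in>T2. fps_X ^ card T :: int fps) = of_nat (j - i - 1) * fps_X ^ 2"
    proof -
      have "inj_on (\<lambda>a. {a, j}) {i<..<j}"
        by (auto simp: inj_on_def doubleton_eq_iff)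
      moreover have "card {a, j} = 2" if "a \<in> {i<..<j}" for a
        using that by auto
      ultimately show ?thesis
        unfolding T2_def by (simp add: sum.reindex power2_eq_square)
    qed
    moreover have "T1 \<inter> T2 = {}" by (auto simp: T1_def T2_def)
    moreover have "finite T1" "finite T2" "{} \<notin> T1 \<union> T2" by (auto simp: T1_def T2_def)
    \<comment> \<open>The number of pairs is a truncated difference of naturals;
      \<open>i < j\<close> makes it equal to the integer coefficient.\<close>
    moreover have "fps_const (int j - int i - 1) = of_nat (j - i - 1)"
    proof -
      have "int j - int i - 1 = int (j - i - 1)" using assms by simp
      then show ?thesis by (simp only: fps_of_nat)
    qed
    ultimately show ?thesis
      by (simp add: sum.union_disjoint fps_of_nat add.assoc del: of_nat_diff)
  qed
  finally show ?thesis by (simp add: mult.commute)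
qed

theorem theorem2p3:
  fixes n i j :: nat
    and R :: "('k::field) mpoly ring"
    and I :: "'k mpoly set"
  assumes "1 \<le> i" and "i < j" and "j \<le> n"
    and "R = poly_ring_upto n"
    and "I = (Idl\<^bsub>R\<^esub> {var l ^ 2 | l. l \<in> {1..n}}) <+>\<^bsub>R\<^esub> RLex n (var_mon i + var_mon j)"
  shows "quotient_HS n I =
    (1 + fps_X) ^ (n - j) *
      (1 + fps_const (int j) * fps_X + fps_const (int j - int i - 1) * fps_X ^ 2)"
proof -
  let ?Q = "(\<lambda>l. Poly_Mapping.single l 2) ` {1..n} :: monomial set"
  let ?P = "support_monomial ` revlex_pairs n i j"
  have "var l ^ 2 = (monom_poly (Poly_Mapping.single l 2) :: 'k mpoly)" for l
    by (simp add: var_def monom_poly_def var_mon_def power2_eq_square mult_single numeral_2_eq_2 flip: single_add)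
  then have squares: "{var l ^ 2 | l. l \<in> {1..n}} = (monom_poly ` ?Q :: 'k mpoly set)"
    by auto
  have fin: "finite T" if "T \<in> revlex_pairs n i j" for T
    using that by (auto simp: revlex_pairs_def)
  have "?Q \<subseteq> monomials n"
    by (auto simp: monomials_def)
  moreover have "?P \<subseteq> monomials n"
    by (auto simp: revlex_pairs_def support_monomial_in_monomials)
  \<comment> \<open>Both summands are generated by monomials, so \<open>I\<close> is the span of the
    multiples of the squares and the \<open>x_T\<close>.\<close>
  ultimately have "I = monomial_span (monomial_multiples n (?Q \<union> ?P))"
    unfolding assms(5,4) RLex_def RLex_generators[OF assms(2)] squares by (rule sum_Idl_monomials)
  \<comment> \<open>The remaining side condition holds because a set \<open>{a, b}\<close> is never
    empty.\<close>
  then have "quotient_HS n I = (\<Sum>S | S \<subseteq> {1..n} \<and> (\<forall>T\<in>revlex_pairs n i j. \<not> T \<subseteq> S). fps_X ^ card S)"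
    using quotient_HS_squares_plus_squarefree[of "revlex_pairs n i j", OF fin _ refl] by (simp add: revlex_pairs_def)
  also have "\<dots> = (1 + fps_X) ^ (n - j) *
      (1 + fps_const (int j) * fps_X + fps_const (int j - int i - 1) * fps_X ^ 2)"
    by (rule sum_revlex_pairs_avoiding[OF assms(1-3)])
  finally show ?thesis .
qed

end
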